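(* Let $a,b$ be positive integers with $ab=n>1$. Let $\rho(a,b)$ denote the number of pairs $(x,y)$ of integers such that $1<x<y$ and $xy\mid ax+by-1$. Then for every real number $\alpha$ with $1\le\alpha\le\sqrt n$, $$\rho(a,b)<\frac1\alpha\sqrt n\,\log n+2\left(1+\frac{0.6}{\alpha}\right)\sqrt n+\frac{(2n-1)\alpha}{2\sqrt n-\alpha}.$$
   Context: $\log$ is the natural logarithm. *)

theory Defs
  imports Complex_Main
begin

definition rho_pairs :: "int \<Rightarrow> int \<Rightarrow> (int \<times> int) set" where
  "rho_pairs a b = {(x, y). 1 < x \<and> x < y \<and> x * y dvd a * x + b * y - 1}"

definition rho :: "int \<Rightarrow> int \<Rightarrow> nat" where
  "rho a b = card (rho_pairs a b)"

text \<open>Since \<open>card\<close> is 0 on infinite sets, \<open>rho\<close> is a genuine count only because of the following.\<close>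

lemma finite_rho_pairs:
  assumes "a > 0" and "b > 0"
  shows "finite (rho_pairs a b)"
proof (rule finite_subset)
  show "rho_pairs a b \<subseteq> {0..a + b} \<times> {0..a * (a + b)}"
  proof
    fix p assume "p \<in> rho_pairs a b"
    then obtain x y where p: "p = (x, y)" and x: "1 < x" and y: "x < y"
      and d: "x * y dvd a * x + b * y - 1"
      by (auto simp: rho_pairs_def)
    have ax: "a * x \<ge> x" and by_pos: "b * y > 0"
      using assms x y by (auto simp: mult_le_cancel_right1)
    have "x * y \<le> a * x + b * y - 1"
      using zdvd_imp_le[OF d] ax by_pos x by linarith
    also have "\<dots> < a * y + b * y"
      using mult_left_mono[of x y a] assms y by linarith
    finally have "x * y < (a + b) * y"
      by (simp add: distrib_right)
    then have xle: "x < a + b"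
      using x y by (simp add: mult_less_cancel_right)
    have "y dvd (a * x - 1) + b * y"
      using dvd_mult_right[OF d] by (simp add: algebra_simps)
    then have "y dvd a * x - 1"
      by (simp add: dvd_add_left_iff)
    then have "y \<le> a * x - 1"
      using zdvd_imp_le[of y "a * x - 1"] ax x by linarith
    moreover have "a * x \<le> a * (a + b)"
      using xle assms by (intro mult_left_mono) auto
    ultimately show "p \<in> {0..a + b} \<times> {0..a * (a + b)}"
      using p x y xle by auto
  qed
qed simp

end

theory Submission
  imports Defs "HOL-Analysis.Harmonic_Numbers"
begin

text \<open>
  If \<open>a x + b y - 1 = k x y\<close>, put \<open>z = k x - b\<close> and \<open>w = k y - a\<close>. Then
  \<open>z w = n - k\<close>, \<open>a x - 1 = y z\<close> and \<open>b y - 1 = x w\<close>. Let \<open>K = sqrt n / \<alpha>\<close>.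
  A solution with \<open>k \<le> K\<close> is determined by \<open>(z, k)\<close>, and also by \<open>(w, k)\<close>. One of \<open>z, w\<close> is at most
  \<open>sqrt n\<close>, and each value \<open>d\<close> of it leaves fewer than \<open>K / d + 1\<close> values of \<open>k\<close>, because
  \<open>k \<equiv> n (mod d)\<close>; this gives the harmonic sum.
  A solution with \<open>k > K\<close> is determined by \<open>y\<close>, because \<open>x < y\<close> is the inverse of \<open>a\<close>
  modulo \<open>y\<close>; and \<open>y \<le> (2 n - 1) / (2 K - 1)\<close>, the extreme case being \<open>b = 1\<close>, \<open>x = 2\<close>.
\<close>

section \<open>Harmonic numbers and counting in residue classes\<close>

lemma harm_less_ln_Suc:
  assumes "m > 0"
  shows "harm m < ln (real m + 1) + 0.6"
proof -
  obtain j where j: "m = Suc j"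
    using assms gr0_implies_Suc by blast
  have "harm m + 1 / real (2 * (j + 2)) \<le> euler_mascheroni + ln (real (j + 2))"
    using euler_mascheroni_lower[of j] unfolding j by linarith
  moreover have "1 / real (2 * (j + 2)) \<ge> 0"
    by simp
  ultimately have "harm m \<le> euler_mascheroni + ln (real (j + 2))"
    by linarith
  also have "real (j + 2) = real m + 1"
    using j by simp
  finally have "harm m \<le> euler_mascheroni + ln (real m + 1)" .
  \<comment> \<open>Since 13/22 < 0.6, this is the source of the constant 0.6 in the
    theorem.\<close>
  then show ?thesis
    using euler_mascheroni_less_13_over_22 by simp
qed

text \<open>All these \<open>k - 1\<close> leave the same remainder modulo \<open>d\<close>, so
  their quotients by \<open>d\<close> tell them apart. Shifting \<open>k\<close> by 1 gives the
  numerator \<open>M - 1\<close>; the 1 saved here is spent in \<open>harm_sum_less\<close>.\<close>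

lemma card_residue_class_le:
  fixes d M n :: int
  assumes "d > 0" and "M \<ge> 1"
  shows "real (card {k \<in> {1..M}. d dvd n - k}) \<le> (M - 1) / d + 1"
proof -
  let ?S = "{k \<in> {1..M}. d dvd n - k}"
  have "inj_on (\<lambda>k. (k - 1) div d) ?S"
  proof (rule inj_onI)
    fix k l assume k: "k \<in> ?S" and l: "l \<in> ?S" and eq: "(k - 1) div d = (l - 1) div d"
    have "d dvd (n - l) - (n - k)"
      using k l by (blast intro: dvd_diff[of d "n - l" "n - k"])
    then have "(k - 1) mod d = (l - 1) mod d"
      by (simp add: mod_eq_dvd_iff)
    then have "k - 1 = l - 1"
      using eq by (metis div_mult_mod_eq)
    then show "k = l"
      by simp
  qed
  moreover have "(\<lambda>k. (k - 1) div d) ` ?S \<subseteq> {0..(M - 1) div d}"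
    using assms by (auto intro!: zdiv_mono1 simp: pos_imp_zdiv_nonneg_iff)
  ultimately have "card ?S \<le> card {0..(M - 1) div d}"
    by (intro card_inj_on_le) auto
  also have "real \<dots> = of_int ((M - 1) div d) + 1"
    using assms by (simp add: pos_imp_zdiv_nonneg_iff)
  also have "of_int ((M - 1) div d) \<le> (M - 1) / d"
    by (metis floor_divide_of_int_eq of_int_floor_le)
  finally show ?thesis
    by simp
qed

text \<open>Meant for \<open>f\<close> equal to z or to w, and \<open>g\<close> equal to k: the
  residue class bounds add up over the possible values of \<open>f\<close>.\<close>

lemma card_le_harm:
  fixes f g :: "'p \<Rightarrow> int" and M n :: int and m :: nat
  assumes inj: "inj_on (\<lambda>p. (f p, g p)) S"
    and mem: "\<And>p. p \<in> S \<Longrightarrow> f p \<in> {1..int m} \<and> g p \<in> {1..M} \<and> f p dvd n - g p"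
    and M: "M \<ge> 1"
  shows "real (card S) \<le> (M - 1) * harm m + m"
proof -
  let ?C = "\<lambda>d. {k \<in> {1..M}. d dvd n - k}"
  have fin: "finite (?C d)" for d
    by (rule finite_subset[of _ "{1..M}"]) auto
  have "card S \<le> card (SIGMA d:{1..int m}. ?C d)"
    using mem fin by (intro card_inj_on_le[OF inj] finite_SigmaI) auto
  also have "\<dots> = (\<Sum>d = 1..int m. card (?C d))"
    using fin by (intro card_SigmaI) auto
  also have "real \<dots> \<le> (\<Sum>d = 1..int m. (M - 1) / d + 1)"
    unfolding of_nat_sum using M by (intro sum_mono card_residue_class_le) auto
  also have "\<dots> = (\<Sum>d = 1..m. (M - 1) / d + 1)"
    by (rule sum.reindex_bij_witness[of _ int nat]) auto
  also have "\<dots> = (M - 1) * harm m + m"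
    by (simp add: sum.distrib harm_def sum_distrib_left divide_inverse)
  finally show ?thesis
    by simp
qed

section \<open>The quotient k and the factors z and w attached to a solution\<close>

definition quot :: "int \<Rightarrow> int \<Rightarrow> int \<times> int \<Rightarrow> int" where
  "quot a b = (\<lambda>(x, y). (a * x + b * y - 1) div (x * y))"

text \<open>Here \<open>k * x - b\<close> is z and \<open>k * y - a\<close> is w. Their equations
  regroup \<open>a * x + b * y - 1 = k * (x * y)\<close>, and both are positive because
  \<open>a * x - 1\<close> and \<open>b * y - 1\<close> are.\<close>

lemma rho_pairs_quot:
  fixes a b x y :: int
  assumes ab: "a > 0" "b > 0" and p: "(x, y) \<in> rho_pairs a b"
  defines "k \<equiv> quot a b (x, y)"
  shows "1 < x" "x < y" "k \<ge> 1" "k * x - b \<ge> 1" "k * y - a \<ge> 1"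
    and "y * (k * x - b) = a * x - 1" "x * (k * y - a) = b * y - 1"
    and "(k * x - b) * (k * y - a) = a * b - k"
proof -
  show x: "1 < x" and y: "x < y"
    using p by (auto simp: rho_pairs_def)
  have k: "a * x + b * y - 1 = k * (x * y)"
    using p by (simp add: rho_pairs_def k_def quot_def)
  have ax: "a * x > 1" and bY: "b * y > 1"
    using ab x y mult_right_mono[of 1 a x] mult_right_mono[of 1 b y] by linarith+
  have "k * (x * y) > 0"
    using k ax bY by linarith
  moreover have xy: "x * y > 0"
    using x y by simp
  ultimately show "k \<ge> 1"
    by (simp add: zero_less_mult_iff)
  show yz: "y * (k * x - b) = a * x - 1" and xw: "x * (k * y - a) = b * y - 1"
    using k by (auto simp: algebra_simps)
  have "y * (k * x - b) > 0" "x * (k * y - a) > 0"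
    using yz xw ax bY by linarith+
  then show "k * x - b \<ge> 1" "k * y - a \<ge> 1"
    using x y by (simp_all add: zero_less_mult_iff)
  have "(k * x - b) * (k * y - a) = k * (k * (x * y)) - k * (a * x) - k * (b * y) + a * b"
    by (simp add: algebra_simps)
  also have "\<dots> = a * b - k"
    unfolding k[symmetric] by (simp add: algebra_simps)
  finally show "(k * x - b) * (k * y - a) = a * b - k" .
qed

text \<open>As k is nonzero, z and k determine \<open>x\<close>. Then y z = a x - 1 with z nonzero
  determines \<open>y\<close>.\<close>

lemma inj_on_fst_quot:
  assumes "a > 0" "b > 0"
  shows "inj_on (\<lambda>p. (quot a b p * fst p - b, quot a b p)) (rho_pairs a b)"
proof (rule inj_onI)
  fix p q assume pq: "p \<in> rho_pairs a b" "q \<in> rho_pairs a b"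
    and eq: "(quot a b p * fst p - b, quot a b p) = (quot a b q * fst q - b, quot a b q)"
  obtain x y x' y' where p: "p = (x, y)" and q: "q = (x', y')"
    by (meson surj_pair)
  note P = rho_pairs_quot[OF assms pq(1)[unfolded p]]
  note Q = rho_pairs_quot[OF assms pq(2)[unfolded q]]
  have k: "quot a b (x, y) = quot a b (x', y')"
    using eq p q by simp
  have x: "x = x'"
    using eq p q P(3) by auto
  have "y * (quot a b (x, y) * x - b) = y' * (quot a b (x, y) * x - b)"
    using P(6) Q(6) x k by simp
  then show "p = q"
    using x p q P(4) by auto
qed

lemma inj_on_snd_quot:
  assumes "a > 0" "b > 0"
  shows "inj_on (\<lambda>p. (quot a b p * snd p - a, quot a b p)) (rho_pairs a b)"
proof (rule inj_onI)
  fix p q assume pq: "p \<in> rho_pairs a b" "q \<in> rho_pairs a b"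
    and eq: "(quot a b p * snd p - a, quot a b p) = (quot a b q * snd q - a, quot a b q)"
  obtain x y x' y' where p: "p = (x, y)" and q: "q = (x', y')"
    by (meson surj_pair)
  note P = rho_pairs_quot[OF assms pq(1)[unfolded p]]
  note Q = rho_pairs_quot[OF assms pq(2)[unfolded q]]
  have k: "quot a b (x, y) = quot a b (x', y')"
    using eq p q by simp
  have y: "y = y'"
    using eq p q P(3) by auto
  have "x * (quot a b (x, y) * y - a) = x' * (quot a b (x, y) * y - a)"
    using P(7) Q(7) y k by simp
  then show "p = q"
    using y p q P(5) by auto
qed

lemma inj_on_snd_rho_pairs:
  assumes "a > 0" "b > 0"
  shows "inj_on snd (rho_pairs a b)"
proof (rule inj_onI)
  fix p q assume pq: "p \<in> rho_pairs a b" "q \<in> rho_pairs a b" and eq: "snd p = snd q"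
  obtain x x' y where p: "p = (x, y)" and q: "q = (x', y)"
    using eq by (metis prod.collapse)
  note P = rho_pairs_quot[OF assms pq(1)[unfolded p]]
  note Q = rho_pairs_quot[OF assms pq(2)[unfolded q]]
  have d: "y dvd a * x - 1" and d': "y dvd a * x' - 1"
    using P(6) Q(6) by (metis dvd_triv_left)+
  \<comment> \<open>Coprimality allows cancelling \<open>a\<close> from \<open>a * (x - x')\<close>;
    both \<open>x\<close> and \<open>x'\<close> lie between 0 and \<open>y\<close>, so congruence
    makes them equal.\<close>
  have "coprime y a"
  proof (rule coprimeI)
    fix c assume "c dvd y" "c dvd a"
    then have "c dvd a * x - (a * x - 1)"
      using d by (blast intro: dvd_diff[of c "a * x" "a * x - 1"] dvd_trans dvd_mult2)
    then show "is_unit c"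
      by simp
  qed
  moreover have "y dvd a * (x - x')"
    using dvd_diff[OF d d'] by (simp add: algebra_simps)
  ultimately have "y dvd x - x'"
    by (simp add: coprime_dvd_mult_right_iff)
  then have "x mod y = x' mod y"
    by (simp add: mod_eq_dvd_iff)
  then show "p = q"
    using P(1,2) Q(1,2) p q by simp
qed

section \<open>Bounding y when k is large\<close>

lemma rho_pairs_snd_le:
  fixes a b x y :: int and K :: real
  assumes ab: "a > 0" "b > 0" and p: "(x, y) \<in> rho_pairs a b"
    and K: "K \<ge> 1" and k: "K < quot a b (x, y)"
  shows "y \<le> (2 * real_of_int (a * b) - 1) / (2 * K - 1)"
proof -
  define k where "k = quot a b (x, y)"
  note P = rho_pairs_quot[OF ab p, folded k_def]
  have Kk: "K < k"
    using \<open>K < _\<close> by (simp add: k_def)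
  \<comment> \<open>For large \<open>b\<close>, z \<ge> 1 gives w \<le> z w = a b - k, and
    \<open>a * (2 * K - 1)\<close> is at most \<open>a * b\<close>. For small \<open>b\<close> the
    argument also uses \<open>x \<ge> 2\<close>.\<close>
  have "y * (2 * K - 1) \<le> 2 * real_of_int (a * b) - 1"
  proof (cases "2 * K - 1 \<le> b")
    case True
    have "1 * (k * y - a) \<le> (k * x - b) * (k * y - a)"
      using P(4,5) by (intro mult_right_mono) auto
    then have "k * (y + 1) \<le> a + a * b"
      using P(8) by (simp add: algebra_simps)
    then have "real_of_int k * (y + 1) \<le> real_of_int (a + a * b)"
      by (metis of_int_le_iff of_int_mult of_int_add of_int_1)
    moreover have "K * (y + 1) \<le> real_of_int k * (y + 1)"
      using Kk P(1,2) by (intro mult_right_mono) auto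
    ultimately have "K * (y + 1) * (2 * K - 1) \<le> (a + a * b) * (2 * K - 1)"
      using K by (intro mult_right_mono) auto
    also have "\<dots> = a * (2 * K - 1) + a * b * (2 * K - 1)"
      by (simp add: algebra_simps)
    also have "\<dots> \<le> a * b + a * b * (2 * K - 1)"
      using True ab by (intro add_right_mono mult_left_mono) auto
    finally have "K * ((y + 1) * (2 * K - 1)) \<le> K * (2 * (a * b))"
      by (simp add: algebra_simps)
    then have "(y + 1) * (2 * K - 1) \<le> 2 * (a * b)"
      using K by (subst (asm) mult_le_cancel_left_pos) auto
    then show ?thesis
      using K by (simp add: algebra_simps)
  next
    case False
    have "(k * x - b) * (k * y - a) \<ge> 0"
      using P(4,5) by (intro mult_nonneg_nonneg) auto
    then have "(x - 2) * (a * b - k) \<ge> 0"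
      using P(1,8) by auto
    \<comment> \<open>At \<open>x = 2\<close> the equation y z = a x - 1 reads
      \<open>y * (2 * k - b) = 2 * a - 1\<close>. The identity shows that for larger
      \<open>x\<close> this persists as an upper bound.\<close>
    moreover have "(2 * a - 1) * (k * x - b) - (y * (k * x - b)) * (2 * k - b) = (x - 2) * (a * b - k)"
      unfolding P(6) by (simp add: algebra_simps)
    ultimately have "(k * x - b) * (y * (2 * k - b)) \<le> (k * x - b) * (2 * a - 1)"
      by (simp add: mult_ac)
    then have le: "y * (2 * k - b) \<le> 2 * a - 1"
      using P(4) by (subst (asm) mult_le_cancel_left_pos) auto
    \<comment> \<open>As a function of \<open>b\<close>, the parabola \<open>b * (2 * K - b)\<close>
      equals \<open>2 * K - 1\<close> at 1 and at \<open>2 * K - 1\<close>, and is no smaller in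
      between.\<close>
    have "b * (2 * K - b) - (2 * K - 1) = (real_of_int b - 1) * (2 * K - 1 - b)"
      by (simp add: algebra_simps)
    moreover have "\<dots> \<ge> 0"
      using False ab by (intro mult_nonneg_nonneg) auto
    ultimately have "y * (2 * K - 1) \<le> y * (b * (2 * K - b))"
      using P(1,2) by (intro mult_left_mono) auto
    also have "\<dots> \<le> real_of_int y * (real_of_int b * (2 * real_of_int k - real_of_int b))"
      using Kk ab P(1,2) by (intro mult_left_mono) auto
    also have "\<dots> = real_of_int (b * (y * (2 * k - b)))"
      by simp
    also have "\<dots> \<le> real_of_int (b * (2 * a - 1))"
      using le ab unfolding of_int_le_iff by (intro mult_left_mono) auto
    also have "\<dots> \<le> 2 * real_of_int (a * b) - 1"
      using ab by (simp add: algebra_simps)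
    finally show ?thesis .
  qed
  then show ?thesis
    using K by (simp add: pos_le_divide_eq)
qed

text \<open>Replacing \<open>ln (m + 1)\<close> by \<open>ln s\<close> costs at most
  \<open>(m + 1 - s) / s\<close>. Multiplied by \<open>K \<le> s\<close>, this is at most
  \<open>m + 1 - s\<close>, which the 1 saved in \<open>M - 1\<close> and \<open>m \<le> s\<close>
  absorb.\<close>

lemma harm_sum_less:
  fixes s K M :: real and m :: nat
  assumes m: "m \<ge> 1" "m \<le> s" "s < real m + 1" and K: "1 \<le> K" "K \<le> s" and M: "1 \<le> M" "M \<le> K"
  shows "(M - 1) * harm m + m < K * ln s + s + 0.6 * K"
proof -
  have "harm m \<ge> (harm 1 :: real)"
    using m by (intro harm_mono) auto
  then have "harm m \<ge> (1 :: real)"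
    by (simp add: harm_expand)
  then have "(M - 1) * harm m \<le> K * harm m - 1"
    using mult_right_mono[of M K "harm m :: real"] M by (simp add: algebra_simps)
  moreover have "K * (harm m - ln s - 0.6) < (real m + 1 - s)"
  proof -
    have s: "s > 0"
      using K by linarith
    have "harm m - ln s - 0.6 < ln (real m + 1) - ln s"
      using harm_less_ln_Suc[of m] m by auto
    also have "\<dots> = ln ((real m + 1) / s)"
      using s by (simp add: ln_div)
    also have "\<dots> \<le> (real m + 1) / s - 1"
      using s by (intro ln_le_minus_one) auto
    also have "\<dots> = (real m + 1 - s) / s"
      using s by (simp add: field_simps)
    finally have "K * (harm m - ln s - 0.6) < K * ((real m + 1 - s) / s)"
      using K by (intro mult_strict_left_mono) auto
    also have "\<dots> \<le> s * ((real m + 1 - s) / s)"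
      using K m s by (intro mult_right_mono) auto
    finally show ?thesis
      using s by simp
  qed
  \<comment> \<open>The terms left over are \<open>- 1 + (m + 1 - s) + m = 2 * m - s\<close>, at
    most \<open>s\<close>.\<close>
  ultimately show ?thesis
    using m by (simp add: algebra_simps)
qed

section \<open>Splitting the solutions and adding the three counts\<close>

theorem theorem1:
  fixes a b n :: int and \<alpha> :: real
  assumes "a > 0" and "b > 0" and "a * b = n" and "n > 1"
    and "1 \<le> \<alpha>" and "\<alpha> \<le> sqrt (real_of_int n)"
  shows "real (rho a b) <
      1 / \<alpha> * sqrt (real_of_int n) * ln (real_of_int n)
      + 2 * (1 + 0.6 / \<alpha>) * sqrt (real_of_int n)
      + (2 * real_of_int n - 1) * \<alpha> / (2 * sqrt (real_of_int n) - \<alpha>)"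
proof -
  note ab = assms(1,2)
  define s where "s = sqrt (real_of_int n)"
  define K where "K = s / \<alpha>"
  define M where "M = \<lfloor>K\<rfloor>"
  define m where "m = nat \<lfloor>s\<rfloor>"
  define H where "H = (M - 1) * harm m + m"
  define Y where "Y = (2 * real_of_int n - 1) / (2 * K - 1)"
  have s: "s \<ge> 1" "s * s = real_of_int n"
    using assms by (auto simp: s_def)
  \<comment> \<open>The two bounds on \<open>\<alpha>\<close> enter here:
    \<open>\<alpha> \<le> s\<close> gives the first, \<open>1 \<le> \<alpha>\<close> the
    second.\<close>
  have K: "1 \<le> K" "K \<le> s"
    using assms s by (auto simp: K_def s_def field_simps)
  have M: "1 \<le> M" "M \<le> K"
    using K by (auto simp: M_def)
  have im: "int m = \<lfloor>s\<rfloor>"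
    using s by (simp add: m_def)
  have m: "m \<ge> 1" "m \<le> s" "s < real m + 1"
    using s im by linarith+
  have Y: "Y \<ge> 0"
    using K assms by (auto simp: Y_def)
  let ?Q = "rho_pairs a b" and ?k = "quot a b"
  \<comment> \<open>\<open>A\<close> and \<open>B\<close> hold the solutions with small k and small
    z or small w, and may overlap; \<open>C\<close> holds those with large k.\<close>
  define A where "A = {p \<in> ?Q. ?k p \<le> M \<and> ?k p * fst p - b \<le> int m}"
  define B where "B = {p \<in> ?Q. ?k p \<le> M \<and> ?k p * snd p - a \<le> int m}"
  define C where "C = {p \<in> ?Q. M < ?k p}"
  have "real (card A) \<le> H"
    unfolding H_def
  proof (rule card_le_harm[OF inj_on_subset[OF inj_on_fst_quot[OF ab]]])
    fix p assume "p \<in> A"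
    moreover obtain x y where "p = (x, y)"
      by (meson surj_pair)
    ultimately show "?k p * fst p - b \<in> {1..int m} \<and> ?k p \<in> {1..M} \<and> ?k p * fst p - b dvd n - ?k p"
      using rho_pairs_quot(3,4,8)[OF ab, of x y] assms(3)
      by (auto simp: A_def simp flip: rho_pairs_quot(8)[OF ab])
  qed (use M in \<open>auto simp: A_def\<close>)
  moreover have "real (card B) \<le> H"
    unfolding H_def
  proof (rule card_le_harm[OF inj_on_subset[OF inj_on_snd_quot[OF ab]]])
    fix p assume "p \<in> B"
    moreover obtain x y where "p = (x, y)"
      by (meson surj_pair)
    ultimately show "?k p * snd p - a \<in> {1..int m} \<and> ?k p \<in> {1..M} \<and> ?k p * snd p - a dvd n - ?k p"
      using rho_pairs_quot(3,5,8)[OF ab, of x y] assms(3)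
      by (auto simp: B_def simp flip: rho_pairs_quot(8)[OF ab])
  qed (use M in \<open>auto simp: B_def\<close>)
  moreover have "real (card C) \<le> Y"
  proof -
    have "snd ` C \<subseteq> {1..\<lfloor>Y\<rfloor>}"
    proof
      fix y assume "y \<in> snd ` C"
      then obtain x where p: "(x, y) \<in> ?Q" and "M < ?k (x, y)"
        by (auto simp: C_def)
      then have "K < ?k (x, y)"
        by (simp add: M_def floor_less_iff)
      then show "y \<in> {1..\<lfloor>Y\<rfloor>}"
        using rho_pairs_snd_le[OF ab p K(1)] rho_pairs_quot(1,2)[OF ab p] assms(3)
        by (simp add: Y_def le_floor_iff)
    qed
    moreover have "inj_on snd C"
      by (rule inj_on_subset[OF inj_on_snd_rho_pairs[OF ab]]) (auto simp: C_def)
    ultimately have "card C \<le> card {1..\<lfloor>Y\<rfloor>}"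
      by (intro card_inj_on_le) auto
    then show ?thesis
      using Y by simp linarith
  qed
  moreover have "?Q \<subseteq> A \<union> B \<union> C"
  proof
    fix p assume p: "p \<in> ?Q"
    obtain x y where xy: "p = (x, y)"
      by (meson surj_pair)
    note P = rho_pairs_quot[OF ab p[unfolded xy]]
    \<comment> \<open>Otherwise z and w both exceed \<open>s\<close>, so z w > n, against z w = n -
      k.\<close>
    have "?k p * x - b \<le> int m \<or> ?k p * y - a \<le> int m"
    proof (rule ccontr)
      assume "\<not> ?thesis"
      then have "(int m + 1) * (int m + 1) \<le> (?k p * x - b) * (?k p * y - a)"
        by (intro mult_mono) auto
      then have "(int m + 1) * (int m + 1) \<le> n"
        using P(3,8) xy assms(3) by auto
      then have "(real m + 1) * (real m + 1) \<le> s * s"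
        unfolding s(2) of_int_le_iff[where 'a = real, symmetric] by simp
      then show False
        using mult_strict_mono[of s "real m + 1" s "real m + 1"] m s by linarith
    qed
    then show "p \<in> A \<union> B \<union> C"
      using p xy by (auto simp: A_def B_def C_def)
  qed
  then have "rho a b \<le> card (A \<union> B \<union> C)"
    unfolding rho_def using finite_rho_pairs[OF ab]
    by (intro card_mono) (auto simp: A_def B_def C_def)
  then have "rho a b \<le> card A + card B + card C"
    using card_Un_le[of "A \<union> B" C] card_Un_le[of A B] by linarith
  ultimately have "real (rho a b) \<le> 2 * H + Y"
    by linarith
  also have "\<dots> < 2 * (K * ln s + s + 0.6 * K) + Y"
    using harm_sum_less[OF m K, of M] M by (simp add: H_def)
  \<comment> \<open>This half cancels the factor 2 that comes from counting both \<open>A\<close>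
    and \<open>B\<close>.\<close>
  also have "ln s = ln (real_of_int n) / 2"
    using assms by (simp add: s_def ln_sqrt)
  also have "Y = (2 * real_of_int n - 1) * \<alpha> / (2 * s - \<alpha>)"
    using assms by (simp add: Y_def K_def field_simps)
  finally show ?thesis
    unfolding K_def s_def[symmetric] by (simp add: algebra_simps)
qed

end
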